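(* Let $N\ge 2$, $T>0$, and let $A$ be a real $N\times N$ Jacobi matrix with diagonal entries $b_1,\dots,b_N$ and off-diagonal entries $a_1,\dots,a_{N-1}>0$. For $k=1,\dots,N$ let $f_k^T\in\mathcal{F}^T_1$ be the control with $W^Tf_k^T=d_k$, where $d_k$ is the $k$-th standard basis vector of $\mathbb{R}^N$. Then the entries of $A$ are recovered by $$b_n=-\left((C^Tf_n^T)'',f_n^T\right)_{L_2(0,T)},\qquad n=1,\dots,N,$$ $$a_n=-\left((C^Tf_n^T)'',f_{n+1}^T\right)_{L_2(0,T)}=-\left((C^Tf_{n+1}^T)'',f_n^T\right)_{L_2(0,T)},\qquad n=1,\dots,N-1.$$
   Context: All functions and spaces are real. $A$ is the symmetric tridiagonal $N\times N$ matrix with diagonal entries $b_1,\dots,b_N\in\mathbb{R}$ and $A_{i,i+1}=A_{i+1,i}=a_i>0$, $i=1,\dots,N-1$. Its eigenvalues $\lambda_1,\dots,\lambda_N$ are real and distinct; $\varphi_k\in\mathbb{R}^N$ is the eigenvector for $\lambda_k$ normalized to have first component equal to $1$, and $\rho_k=(\varphi_k,\varphi_k)_{\mathbb{R}^N}$. Put $S(t,\lambda)=\frac{\sin(\sqrt{\lambda}\,t)}{\sqrt{\lambda}}$ if $\lambda>0$, $S(t,\lambda)=\frac{\sinh(\sqrt{|\lambda|}\,t)}{\sqrt{|\lambda|}}$ if $\lambda<0$, $S(t,0)=t$, and $S_k(t)=S(t,\lambda_k)$. The dynamical system is $u_{tt}(t)+Au(t)=F(t)$, $t>0$, $u(0)=u_t(0)=0$,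 with $F(t)=(f(t),0,\dots,0)$, $f\in\mathcal{F}^T:=L_2(0,T)$; its solution is denoted $u^f$. One has $u^f(t)=\sum_{k=1}^N\frac1{\rho_k}\int_0^tf(\tau)S_k(t-\tau)\,d\tau\,\varphi_k$. The control operator is $W^T:\mathcal{F}^T\to\mathbb{R}^N$, $W^Tf=u^f(T)$ ($\mathbb{R}^N$ with the standard inner product), the connecting operator is $C^T=(W^T)^*W^T:\mathcal{F}^T\to\mathcal{F}^T$, and $\mathcal{F}^T_1=\operatorname{span}\{S_k(T-\cdot)\}_{k=1}^N\subset L_2(0,T)$. The restriction of $W^T$ to $\mathcal{F}^T_1$ is an isomorphism onto $\mathbb{R}^N$, so the controls $f_k^T$ exist and are unique. Primes denote derivatives in $t$. *)

theory Defs
  imports "HOL-Analysis.Analysis" "Jordan_Normal_Form.Spectral_Radius"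
begin

unbundle no vec_syntax
unbundle no inner_syntax

text \<open>The space \<open>L\<^sub>2(0,T)\<close> is represented by functions on the whole line, of which only
  the restriction to the open interval \<open>(0,T)\<close>, up to null sets, is relevant.\<close>

definition L2 :: "real \<Rightarrow> (real \<Rightarrow> real) set" where
  "L2 T = {f. f \<in> borel_measurable (lebesgue_on {0<..<T}) \<and>
              integrable (lebesgue_on {0<..<T}) (\<lambda>t. (f t)\<^sup>2)}"

definition L2_eq :: "real \<Rightarrow> (real \<Rightarrow> real) \<Rightarrow> (real \<Rightarrow> real) \<Rightarrow> bool" where
  "L2_eq T f g \<longleftrightarrow> (AE t in lebesgue_on {0<..<T}. f t = g t)"

definition L2_inner :: "real \<Rightarrow> (real \<Rightarrow> real) \<Rightarrow> (real \<Rightarrow> real) \<Rightarrow> real" where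
  "L2_inner T f g = (LINT t|lebesgue_on {0<..<T}. f t * g t)"

text \<open>The second derivative of a class in \<open>L\<^sub>2(0,T)\<close> is the classical second derivative on
  \<open>(0,T)\<close> of its twice differentiable representative. The latter is unique on \<open>(0,T)\<close>,
  since continuous functions that agree almost everywhere there agree everywhere there.\<close>

definition L2_second_deriv :: "real \<Rightarrow> (real \<Rightarrow> real) \<Rightarrow> real \<Rightarrow> real" where
  "L2_second_deriv T g = (SOME g2. \<exists>g0 g1. L2_eq T g0 g \<and>
     (\<forall>t\<in>{0<..<T}. (g0 has_real_derivative g1 t) (at t) \<and>
                    (g1 has_real_derivative g2 t) (at t)))"

text \<open>The adjoint of \<open>W : L\<^sub>2(0,T) \<rightarrow> \<real>\<^sup>N\<close>, cf. the library's constant \<open>adjoint\<close>; its values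
  are determined up to null sets, and an arbitrary representative is chosen.\<close>

definition L2_adjoint :: "real \<Rightarrow> ((real \<Rightarrow> real) \<Rightarrow> real vec) \<Rightarrow> real vec \<Rightarrow> real \<Rightarrow> real" where
  "L2_adjoint T W y = (SOME g. g \<in> L2 T \<and> (\<forall>f\<in>L2 T. W f \<bullet> y = L2_inner T f g))"

text \<open>Matrix and vector indices of the library start at 0, those of \<open>a\<close> and \<open>b\<close> at 1.\<close>

definition jacobi_mat :: "nat \<Rightarrow> (nat \<Rightarrow> real) \<Rightarrow> (nat \<Rightarrow> real) \<Rightarrow> real mat" where
  "jacobi_mat N a b = mat N N (\<lambda>(i, j).
     if i = j then b (i + 1)
     else if j = i + 1 then a (i + 1)
     else if i = j + 1 then a (j + 1)
     else 0)"

definition S :: "real \<Rightarrow> real \<Rightarrow> real" where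
  "S t l = (if l > 0 then sin (sqrt l * t) / sqrt l
            else if l < 0 then sinh (sqrt \<bar>l\<bar> * t) / sqrt \<bar>l\<bar>
            else t)"

text \<open>Solutions on \<open>[0,T]\<close> of \<open>u'' + A u = (f,0,\<dots>,0)\<close>, \<open>u(0) = u'(0) = 0\<close>. As \<open>f\<close> is only
  square integrable, they are taken in the sense of Caratheodory: \<open>u\<close> is continuously
  differentiable, \<open>u'\<close> is absolutely continuous, that is, the indefinite integral of an integrable
  function \<open>u''\<close>, and the equation holds almost everywhere. The condition \<open>u'(0) = 0\<close> is the
  case \<open>t = 0\<close> of the integral identity.\<close>

definition solves_system ::
    "real \<Rightarrow> real mat \<Rightarrow> (real \<Rightarrow> real) \<Rightarrow> (real \<Rightarrow> real vec) \<Rightarrow> bool" where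
  "solves_system T A f u \<longleftrightarrow>
     (\<forall>t\<in>{0..T}. u t \<in> carrier_vec (dim_row A)) \<and>
     u 0 = 0\<^sub>v (dim_row A) \<and>
     (\<exists>u1 u2.
        (\<forall>i<dim_row A. \<forall>t\<in>{0..T}.
           ((\<lambda>s. u s $ i) has_real_derivative u1 t $ i) (at t within {0..T})) \<and>
        (\<forall>i<dim_row A. integrable (lebesgue_on {0<..<T}) (\<lambda>s. u2 s $ i)) \<and>
        (\<forall>i<dim_row A. \<forall>t\<in>{0..T}. u1 t $ i = (LINT s|lebesgue_on {0<..<t}. u2 s $ i)) \<and>
        (AE t in lebesgue_on {0<..<T}.
           u2 t \<in> carrier_vec (dim_row A) \<and>
           u2 t + A *\<^sub>v u t = f t \<cdot>\<^sub>v unit_vec (dim_row A) 0))"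

definition control_op :: "real \<Rightarrow> real mat \<Rightarrow> (real \<Rightarrow> real) \<Rightarrow> real vec" where
  "control_op T A f = (THE x. \<exists>u. solves_system T A f u \<and> x = u T)"

definition connecting_op :: "real \<Rightarrow> real mat \<Rightarrow> (real \<Rightarrow> real) \<Rightarrow> real \<Rightarrow> real" where
  "connecting_op T A f = L2_adjoint T (control_op T A) (control_op T A f)"

text \<open>The span of the functions \<open>S(T - \<cdot>, \<lambda>)\<close>, with \<open>\<lambda>\<close> ranging over the eigenvalues of \<open>A\<close>.\<close>

definition control_subspace :: "real \<Rightarrow> real mat \<Rightarrow> (real \<Rightarrow> real) set" where
  "control_subspace T A =
     {f \<in> L2 T. \<exists>c. L2_eq T f (\<lambda>t. \<Sum>l\<in>spectrum A. c l * S (T - t) l)}"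

end

theory Submission
  imports Defs
begin

text \<open>Write \<open>W\<close> for the control operator and \<open>W\<^sup>*\<close> for its adjoint, so that the connecting operator is
  \<open>W\<^sup>* W\<close>. The theorem rests on the relation \<open>(W\<^sup>* y)'' = - W\<^sup>* A y\<close>, which gives
  \<open>- ((W\<^sup>* W f)'', h) = (A W f, W h)\<close>; for controls that steer the system to unit vectors the right-hand side
  is an entry of \<open>A\<close> (lemma \<open>L2_second_deriv_connecting_op\<close>).

  The relation holds because \<open>W\<^sup>*\<close> is an observation of the time-reversed, unforced system. If
  \<open>v'' + A v = 0\<close>, \<open>v(0) = 0\<close>, \<open>v'(0) = y\<close>, then integrating by parts twice yields
  \<open>W f \<bullet> y = \<integral> f(t) v\<^sub>0(T - t) dt\<close>, with \<open>v\<^sub>0\<close> the first component (lemma \<open>solution_dual_free_motion\<close>).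
  Hence \<open>W\<^sup>* y = v\<^sub>0(T - \<cdot>)\<close>, whose second derivative is \<open>- (A v)\<^sub>0(T - \<cdot>)\<close>, and \<open>A v\<close> is the unforced motion
  with initial velocity \<open>A y\<close>.

  Duality also shows that the final state is determined by the control. That solutions exist, for
  forced and unforced motions alike, is shown by a Neumann series
  (lemma \<open>linear_second_order_solution\<close>).\<close>

section \<open>Integration on open intervals\<close>

lemma integrable_lebesgue_on_Ioo_continuous:
  fixes g :: "real \<Rightarrow> real"
  assumes "continuous_on {a..b} g"
  shows "integrable (lebesgue_on {a<..<b}) g"
proof -
  have "g absolutely_integrable_on {a..b}"
    using assms by (rule absolutely_integrable_continuous_real)
  then have "g absolutely_integrable_on {a<..<b}"
    by (rule set_integrable_subset) auto
  then show ?thesis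
    by (rule absolutely_integrable_imp_integrable) auto
qed

lemma LINT_Ioo_continuous:
  fixes g :: "real \<Rightarrow> real"
  assumes "continuous_on {a..b} g"
  shows "(LINT t|lebesgue_on {a<..<b}. g t) = integral {a..b} g"
  using lebesgue_integral_eq_integral[OF integrable_lebesgue_on_Ioo_continuous[OF assms]]
  by (simp add: integral_open_interval_real)

lemma LINT_Ioo_FTC:
  fixes h :: "real \<Rightarrow> real"
  assumes "a \<le> b" "continuous_on {a..b} g"
    and "\<And>t. t \<in> {a..b} \<Longrightarrow> (h has_real_derivative g t) (at t within {a..b})"
  shows "(LINT t|lebesgue_on {a<..<b}. g t) = h b - h a"
proof -
  have "(g has_integral (h b - h a)) {a..b}"
    using assms by (intro fundamental_theorem_of_calculus)
      (auto simp: has_real_derivative_iff_has_vector_derivative[symmetric])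
  then show ?thesis
    using LINT_Ioo_continuous[OF assms(2)] by (simp add: integral_unique)
qed

lemma continuous_on_Icc_bounded:
  fixes g :: "real \<Rightarrow> real"
  assumes "continuous_on {a..b} g"
  obtains K where "\<And>t. t \<in> {a..b} \<Longrightarrow> \<bar>g t\<bar> \<le> K"
proof -
  have "bounded (g ` {a..b})"
    using assms by (intro compact_imp_bounded compact_continuous_image) auto
  then obtain K where "\<forall>y\<in>g ` {a..b}. norm y \<le> K" unfolding bounded_iff by blast
  then show thesis by (intro that[of K]) auto
qed

lemma integrable_mult_continuous:
  fixes p g :: "real \<Rightarrow> real"
  assumes p: "integrable (lebesgue_on {a<..<b}) p" and g: "continuous_on {a..b} g"
  shows "integrable (lebesgue_on {a<..<b}) (\<lambda>t. p t * g t)"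
proof -
  obtain K where K: "\<And>t. t \<in> {a..b} \<Longrightarrow> \<bar>g t\<bar> \<le> K"
    using continuous_on_Icc_bounded[OF g] by blast
  have [measurable]: "g \<in> borel_measurable (lebesgue_on {a<..<b})"
      "p \<in> borel_measurable (lebesgue_on {a<..<b})"
    using integrable_lebesgue_on_Ioo_continuous[OF g] p by auto
  show ?thesis
  proof (rule Bochner_Integration.integrable_bound)
    show "integrable (lebesgue_on {a<..<b}) (\<lambda>t. K * p t)" using p by simp
    show "AE t in lebesgue_on {a<..<b}. norm (p t * g t) \<le> norm (K * p t)"
    proof (rule AE_I2)
      fix t assume "t \<in> space (lebesgue_on {a<..<b})"
      then have "\<bar>g t\<bar> \<le> \<bar>K\<bar>" using K[of t] by force
      then show "norm (p t * g t) \<le> norm (K * p t)"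
        by (simp add: abs_mult mult.commute mult_right_mono)
    qed
  qed measurable
qed

lemma integrable_lebesgue_on_Ioo_subset:
  fixes p :: "real \<Rightarrow> real"
  assumes "integrable (lebesgue_on {a<..<b}) p" "t \<le> b"
  shows "integrable (lebesgue_on {a<..<t}) p"
proof -
  have "set_integrable lebesgue {a<..<b} p"
    using assms(1) by (simp add: integrable_restrict_space set_integrable_def)
  then have "set_integrable lebesgue {a<..<t} p"
    by (rule set_integrable_subset) (use assms(2) in auto)
  then show ?thesis by (simp add: integrable_restrict_space set_integrable_def)
qed

lemma continuous_on_indefinite_LINT:
  fixes p :: "real \<Rightarrow> real"
  assumes p: "integrable (lebesgue_on {a<..<b}) p"
  shows "continuous_on {a..b} (\<lambda>t. LINT s|lebesgue_on {a<..<t}. p s)"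
proof -
  have "p integrable_on {a..b}"
    using integrable_on_lebesgue_on[OF p] by (simp add: integrable_on_open_interval_real)
  then have "continuous_on {a..b} (\<lambda>t. integral {a..t} p)"
    by (rule indefinite_integral_continuous_1)
  moreover have "integral {a..t} p = (LINT s|lebesgue_on {a<..<t}. p s)" if "t \<in> {a..b}" for t
    using that lebesgue_integral_eq_integral[OF integrable_lebesgue_on_Ioo_subset[OF p, of t]]
    by (simp add: integral_open_interval_real)
  ultimately show ?thesis by (rule continuous_on_eq)
qed

lemma LINT_lebesgue_on_indicator:
  fixes h :: "real \<Rightarrow> real"
  assumes "X \<in> sets lebesgue" "Y \<in> sets lebesgue"
  shows "(LINT t|lebesgue_on X. indicator Y t * h t) = (LINT t|lebesgue_on (X \<inter> Y). h t)"
  using assms by (simp add: integral_restrict_space sets.Int indicator_inter_arith mult.assoc)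

text \<open>Integration by parts in which one factor is only absolutely continuous, so that the classical
  product rule is not available. Writing \<open>h s\<close> as \<open>- \<integral>\<^bsub>s\<^esub>\<^bsup>b\<^esup> h' r dr\<close> turns the claim into Fubini's theorem
  on the triangle \<open>s < r\<close>.\<close>

lemma LINT_by_parts_indefinite:
  fixes p h h' :: "real \<Rightarrow> real"
  assumes p: "integrable (lebesgue_on {a<..<b}) p"
    and h': "continuous_on {a..b} h'"
    and h: "\<And>t. t \<in> {a..b} \<Longrightarrow> (h has_real_derivative h' t) (at t within {a..b})"
    and "h b = 0"
  shows "(LINT s|lebesgue_on {a<..<b}. p s * h s) =
         - (LINT r|lebesgue_on {a<..<b}. (LINT s|lebesgue_on {a<..<r}. p s) * h' r)"
proof -
  define M where "M = lebesgue_on {a<..<b}"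
  have spM: "space M = {a<..<b}" by (simp add: M_def)
  interpret M: finite_measure M
    unfolding M_def by (rule finite_measure_lebesgue_on) simp
  interpret MM: pair_sigma_finite M M ..
  have pM: "integrable M p" and h'M: "integrable M h'"
    using p integrable_lebesgue_on_Ioo_continuous[OF h'] by (auto simp: M_def)
  have [measurable]: "p \<in> borel_measurable M" "h' \<in> borel_measurable M"
    using pM h'M by auto
  have id[measurable]: "(\<lambda>x. x) \<in> borel_measurable M"
    unfolding M_def by (intro continuous_imp_measurable_on_sets_lebesgue continuous_intros) auto
  have ind[measurable]: "(\<lambda>x. indicator {fst x<..} (snd x) :: real) \<in> borel_measurable (M \<Otimes>\<^sub>M M)"
  proof -
    have [measurable]: "(\<lambda>x. fst x) \<in> borel_measurable (M \<Otimes>\<^sub>M M)" "(\<lambda>x. snd x) \<in> borel_measurable (M \<Otimes>\<^sub>M M)"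
      using measurable_compose[OF measurable_fst id] measurable_compose[OF measurable_snd id] by auto
    have eq: "(\<lambda>x. indicator {fst x<..} (snd x) :: real) = (\<lambda>x. if fst x < snd x then 1 else 0)"
      by (auto simp: indicator_def)
    show ?thesis unfolding eq by measurable
  qed
  have prod: "integrable (M \<Otimes>\<^sub>M M) (\<lambda>x. p (fst x) * h' (snd x))"
  proof -
    have "integrable (M \<Otimes>\<^sub>M M) (case_prod (\<lambda>x y. p x * h' y))"
      using pM h'M by (intro MM.Fubini_integrable) (auto simp: abs_mult)
    then show ?thesis by (simp add: split_def)
  qed
  have "integrable (M \<Otimes>\<^sub>M M) (case_prod (\<lambda>s r. indicator {s<..} r * (p s * h' r)))"
    unfolding split_def
    by (rule Bochner_Integration.integrable_bound[OF prod]) (auto simp: indicator_def)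
  then have F: "(LINT r|M. (LINT s|M. indicator {s<..} r * (p s * h' r))) =
             (LINT s|M. (LINT r|M. indicator {s<..} r * (p s * h' r)))"
    by (rule MM.Fubini_integral)
  have "(LINT s|M. indicator {s<..} r * (p s * h' r)) = (LINT s|lebesgue_on {a<..<r}. p s) * h' r"
    if "r \<in> space M" for r
  proof -
    have r: "r < b" using that spM by simp
    have "(LINT s|M. indicator {s<..} r * (p s * h' r)) = (LINT s|M. (indicator {..<r} s * p s) * h' r)"
      by (rule Bochner_Integration.integral_cong) (auto simp: indicator_def)
    also have "\<dots> = (LINT s|M. indicator {..<r} s * p s) * h' r" by simp
    also have "(LINT s|M. indicator {..<r} s * p s) = (LINT s|lebesgue_on ({a<..<b} \<inter> {..<r}). p s)"
      unfolding M_def by (rule LINT_lebesgue_on_indicator) auto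
    also have "{a<..<b} \<inter> {..<r} = {a<..<r}" using r unfolding set_eq_iff by auto
    finally show ?thesis .
  qed
  moreover have "(LINT r|M. indicator {s<..} r * (p s * h' r)) = - (p s * h s)"
    if "s \<in> space M" for s
  proof -
    have s: "a < s" "s < b" using that spM by auto
    have "(LINT r|M. indicator {s<..} r * (p s * h' r)) = (LINT r|M. p s * (indicator {s<..} r * h' r))"
      by (rule Bochner_Integration.integral_cong) auto
    also have "\<dots> = p s * (LINT r|M. indicator {s<..} r * h' r)" by simp
    also have "(LINT r|M. indicator {s<..} r * h' r) = (LINT r|lebesgue_on ({a<..<b} \<inter> {s<..}). h' r)"
      unfolding M_def by (rule LINT_lebesgue_on_indicator) auto
    also have "{a<..<b} \<inter> {s<..} = {s<..<b}" using s by auto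
    also have "(LINT r|lebesgue_on {s<..<b}. h' r) = h b - h s"
    proof (rule LINT_Ioo_FTC)
      show "continuous_on {s..b} h'" using s by (intro continuous_on_subset[OF h']) auto
      show "(h has_real_derivative h' t) (at t within {s..b})" if "t \<in> {s..b}" for t
        using s that by (intro DERIV_subset[OF h]) auto
    qed (use s in simp)
    finally show ?thesis using \<open>h b = 0\<close> by simp
  qed
  ultimately have "(LINT r|M. (LINT s|lebesgue_on {a<..<r}. p s) * h' r) = (LINT s|M. - (p s * h s))"
    using F by (simp cong: Bochner_Integration.integral_cong)
  then show ?thesis by (simp add: M_def)
qed

section \<open>The space \<open>L\<^sub>2(0,T)\<close> and its second derivative\<close>

text \<open>The interval has finite measure and \<open>\<bar>x\<bar> \<le> 1 + x\<^sup>2\<close>.\<close>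

lemma L2_imp_integrable:
  assumes "f \<in> L2 T"
  shows "integrable (lebesgue_on {0<..<T}) f"
proof (rule Bochner_Integration.integrable_bound)
  have "integrable (lebesgue_on {0<..<T}) (\<lambda>_. 1 :: real)"
    by (rule integrable_lebesgue_on_Ioo_continuous) auto
  then show "integrable (lebesgue_on {0<..<T}) (\<lambda>t. 1 + (f t)\<^sup>2)"
    using assms by (auto simp: L2_def)
  show "AE t in lebesgue_on {0<..<T}. norm (f t) \<le> norm (1 + (f t)\<^sup>2)"
  proof (rule AE_I2)
    fix t
    have "0 \<le> (\<bar>f t\<bar> - 1)\<^sup>2" by simp
    then have "2 * \<bar>f t\<bar> \<le> 1 + (f t)\<^sup>2" by (simp add: power2_diff)
    then show "norm (f t) \<le> norm (1 + (f t)\<^sup>2)" by simp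
  qed
qed (use assms in \<open>auto simp: L2_def\<close>)

lemma L2_imp_integrable_mult:
  assumes "f \<in> L2 T" "g \<in> L2 T"
  shows "integrable (lebesgue_on {0<..<T}) (\<lambda>t. f t * g t)"
proof (rule Bochner_Integration.integrable_bound)
  show "integrable (lebesgue_on {0<..<T}) (\<lambda>t. (f t)\<^sup>2 + (g t)\<^sup>2)"
    using assms by (auto simp: L2_def)
  show "AE t in lebesgue_on {0<..<T}. norm (f t * g t) \<le> norm ((f t)\<^sup>2 + (g t)\<^sup>2)"
  proof (rule AE_I2)
    fix t
    have "0 \<le> (\<bar>f t\<bar> - \<bar>g t\<bar>)\<^sup>2" by simp
    then have "2 * (\<bar>f t\<bar> * \<bar>g t\<bar>) \<le> (f t)\<^sup>2 + (g t)\<^sup>2" by (simp add: power2_diff)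
    moreover have "0 \<le> \<bar>f t\<bar> * \<bar>g t\<bar>" by simp
    ultimately have "\<bar>f t\<bar> * \<bar>g t\<bar> \<le> (f t)\<^sup>2 + (g t)\<^sup>2" by linarith
    then show "norm (f t * g t) \<le> norm ((f t)\<^sup>2 + (g t)\<^sup>2)" by (simp add: abs_mult)
  qed
qed (use assms in \<open>auto simp: L2_def\<close>)

lemma L2_continuous:
  assumes "continuous_on {0..T} g"
  shows "g \<in> L2 T"
  using integrable_lebesgue_on_Ioo_continuous[OF assms]
    integrable_lebesgue_on_Ioo_continuous[of 0 T "\<lambda>t. (g t)\<^sup>2"] assms
  by (auto simp: L2_def intro!: continuous_intros)

text \<open>The choice in the definition of the second derivative is harmless: two representatives that are
  differentiable on the open interval agree almost everywhere, hence everywhere by continuity, hence so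
  do their derivatives.\<close>

lemma L2_second_deriv_eq:
  assumes g: "L2_eq T h g"
    and h: "\<And>t. t \<in> {0<..<T} \<Longrightarrow> (h has_real_derivative h1 t) (at t)"
    and h1: "\<And>t. t \<in> {0<..<T} \<Longrightarrow> (h1 has_real_derivative h2 t) (at t)"
    and t: "t \<in> {0<..<T}"
  shows "L2_second_deriv T g t = h2 t"
proof -
  define k where "k = L2_second_deriv T g"
  have "\<exists>k g0 g1. L2_eq T g0 g \<and> (\<forall>t\<in>{0<..<T}. (g0 has_real_derivative g1 t) (at t) \<and>
      (g1 has_real_derivative k t) (at t))"
    using g h h1 by blast
  from someI_ex[OF this] obtain g0 g1 where g0: "L2_eq T g0 g"
    and D0: "\<And>t. t \<in> {0<..<T} \<Longrightarrow> (g0 has_real_derivative g1 t) (at t)"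
    and D1: "\<And>t. t \<in> {0<..<T} \<Longrightarrow> (g1 has_real_derivative k t) (at t)"
    unfolding k_def L2_second_deriv_def by blast
  have AE: "AE t in lebesgue. t \<in> {0<..<T} \<longrightarrow> g0 t = h t"
  proof -
    have "AE t in lebesgue_on {0<..<T}. g0 t = h t"
      using g g0 unfolding L2_eq_def by eventually_elim simp
    then show ?thesis by (simp add: AE_restrict_space_iff)
  qed
  have g0h: "g0 t = h t" if "t \<in> {0<..<T}" for t
  proof -
    have "0 < t" "t < T" using that by auto
    then obtain a b where ab: "0 < a" "a < t" "t < b" "b < T" by (metis dense)
    have "isCont g0 s" "isCont h s" if "s \<in> {0<..<T}" for s
      using D0[OF that] h[OF that] by (auto intro: DERIV_isCont)
    then have "continuous_on {a..b} (\<lambda>t. g0 t - h t)"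
      using ab by (intro continuous_at_imp_continuous_on) auto
    then have "closed ({a..b} \<inter> (\<lambda>t. g0 t - h t) -` {0})"
      by (intro continuous_closed_preimage) auto
    moreover have "AE s \<in> {a<..<b} in lebesgue. s \<in> {a..b} \<inter> (\<lambda>t. g0 t - h t) -` {0}"
      using AE by eventually_elim (use ab in auto)
    ultimately have "t \<in> {a..b} \<inter> (\<lambda>t. g0 t - h t) -` {0}"
      by (rule mem_closed_if_AE_lebesgue_open[OF open_greaterThanLessThan]) (use ab in simp)
    then show ?thesis by simp
  qed
  have g1h: "g1 t = h1 t" if t: "t \<in> {0<..<T}" for t
  proof -
    have "(h has_real_derivative g1 t) (at t)"
      using has_field_derivative_transform_within_open[OF D0[OF t], of "{0<..<T}" h] t g0h by auto
    then show ?thesis using h[OF t] by (rule DERIV_unique)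
  qed
  have "(h1 has_real_derivative k t) (at t)"
    using has_field_derivative_transform_within_open[OF D1[OF t], of "{0<..<T}" h1] t g1h by auto
  then show ?thesis using h1[OF t] unfolding k_def by (rule DERIV_unique)
qed

section \<open>Linear second-order systems\<close>

text \<open>The inverse of the second derivative with vanishing initial data.\<close>

definition double_integral :: "(real \<Rightarrow> real) \<Rightarrow> real \<Rightarrow> real" where
  "double_integral P t = integral {0..t} (\<lambda>s. integral {0..s} P)"

text \<open>The vectors \<open>(- B)\<^sup>m c\<close>, the coefficients of the Neumann series used below.\<close>

fun neumann_coeff :: "nat \<Rightarrow> (nat \<Rightarrow> nat \<Rightarrow> real) \<Rightarrow> (nat \<Rightarrow> real) \<Rightarrow> nat \<Rightarrow> nat \<Rightarrow> real" where
  "neumann_coeff N B c 0 i = c i"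
| "neumann_coeff N B c (Suc m) i = - (\<Sum>j<N. B i j * neumann_coeff N B c m j)"

lemma neumann_coeff_bound:
  "(\<Sum>i<N. \<bar>neumann_coeff N B c m i\<bar>) \<le> (\<Sum>i<N. \<Sum>j<N. \<bar>B i j\<bar>) ^ m * (\<Sum>i<N. \<bar>c i\<bar>)"
proof (induction m)
  case (Suc m)
  let ?R = "\<Sum>i<N. \<Sum>j<N. \<bar>B i j\<bar>" and ?c = "neumann_coeff N B c m"
  have "(\<Sum>i<N. \<bar>neumann_coeff N B c (Suc m) i\<bar>) \<le> (\<Sum>i<N. \<Sum>j<N. \<bar>B i j\<bar> * (\<Sum>k<N. \<bar>?c k\<bar>))"
  proof (rule sum_mono)
    fix i
    have "\<bar>\<Sum>j<N. B i j * ?c j\<bar> \<le> (\<Sum>j<N. \<bar>B i j * ?c j\<bar>)" by (rule sum_abs)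
    also have "\<dots> \<le> (\<Sum>j<N. \<bar>B i j\<bar> * (\<Sum>k<N. \<bar>?c k\<bar>))"
      by (auto simp: abs_mult intro!: sum_mono mult_left_mono member_le_sum)
    finally show "\<bar>neumann_coeff N B c (Suc m) i\<bar> \<le> (\<Sum>j<N. \<bar>B i j\<bar> * (\<Sum>k<N. \<bar>?c k\<bar>))" by simp
  qed
  also have "\<dots> = ?R * (\<Sum>k<N. \<bar>?c k\<bar>)" by (simp add: sum_distrib_right)
  also have "\<dots> \<le> ?R * (?R ^ m * (\<Sum>i<N. \<bar>c i\<bar>))"
    by (intro mult_left_mono Suc.IH sum_nonneg) auto
  finally show ?case by (simp add: mult.assoc)
qed simp

lemma continuous_on_integral:
  fixes P :: "real \<Rightarrow> real"
  assumes "continuous_on {0..T} P"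
  shows "continuous_on {0..T} (\<lambda>t. integral {0..t} P)"
  by (rule DERIV_continuous_on[OF integral_has_real_derivative[OF assms]])

lemma continuous_on_funpow_double_integral:
  "continuous_on {0..T} P \<Longrightarrow> continuous_on {0..T} ((double_integral ^^ m) P)"
  by (induction m) (auto simp: double_integral_def[abs_def] intro!: continuous_on_integral)

lemma integral_power_bound:
  fixes P :: "real \<Rightarrow> real"
  assumes P: "continuous_on {0..t} P" and "0 \<le> t"
    and b: "\<And>s. s \<in> {0..t} \<Longrightarrow> \<bar>P s\<bar> \<le> K * s ^ m / fact m"
  shows "\<bar>integral {0..t} P\<bar> \<le> K * t ^ Suc m / fact (Suc m)"
proof -
  have "((\<lambda>s. K / fact (Suc m) * s ^ Suc m) has_real_derivative K * s ^ m / fact m)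
      (at s within {0..t})" for s
    using DERIV_cmult[OF DERIV_pow[of "Suc m" s "{0..t}"], of "K / fact (Suc m)"]
    by (simp add: field_simps del: of_nat_Suc)
  then have *: "((\<lambda>s. K * s ^ m / fact m) has_integral
      (K / fact (Suc m) * t ^ Suc m - K / fact (Suc m) * 0 ^ Suc m)) {0..t}"
    using \<open>0 \<le> t\<close>
    by (intro fundamental_theorem_of_calculus)
      (auto simp: has_real_derivative_iff_has_vector_derivative[symmetric])
  have "norm (integral {0..t} P) \<le> integral {0..t} (\<lambda>s. K * s ^ m / fact m)"
    by (rule integral_norm_bound_integral[OF integrable_continuous_real[OF P] has_integral_integrable[OF *]])
      (use b in auto)
  also have "\<dots> = K * t ^ Suc m / fact (Suc m)"
    using integral_unique[OF *] by simp
  finally show ?thesis by simp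
qed

text \<open>Only one of the two integrations in each step is used to gain a factor \<open>t / (m + 1)\<close>, the other one
  is estimated by \<open>T\<close>. The bound is weaker than the one with \<open>(2 m)!\<close>, but a single
  factorial already beats the geometric growth of the coefficients.\<close>

lemma funpow_double_integral_bounds:
  assumes P: "continuous_on {0..T} P" and K: "\<And>t. t \<in> {0..T} \<Longrightarrow> \<bar>P t\<bar> \<le> K"
    and t: "t \<in> {0..T}"
  shows "\<bar>(double_integral ^^ m) P t\<bar> \<le> K * T ^ m * t ^ m / fact m"
    and "\<bar>integral {0..t} ((double_integral ^^ m) P)\<bar> \<le> K * T ^ m * t ^ Suc m / fact (Suc m)"
proof -
  have 1: "\<bar>integral {0..t} ((double_integral ^^ m) P)\<bar> \<le> K * T ^ m * t ^ Suc m / fact (Suc m)"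
    if b: "\<And>s. s \<in> {0..T} \<Longrightarrow> \<bar>(double_integral ^^ m) P s\<bar> \<le> K * T ^ m * s ^ m / fact m" and "t \<in> {0..T}" for m t
    using that by (intro integral_power_bound continuous_on_subset[OF continuous_on_funpow_double_integral[OF P]]) auto
  have K0: "K \<ge> 0" using K[OF t] by linarith
  have 2: "\<bar>(double_integral ^^ m) P t\<bar> \<le> K * T ^ m * t ^ m / fact m" if "t \<in> {0..T}" for t
    using that
  proof (induction m arbitrary: t)
    case 0
    then show ?case using K by simp
  next
    case (Suc m)
    let ?L = "K * T ^ m * t ^ Suc m / fact (Suc m)"
    have "norm (integral {0..t} (\<lambda>s. integral {0..s} ((double_integral ^^ m) P))) \<le> ?L * (t - 0)"
    proof (rule integral_bound)
      show "continuous_on {0..t} (\<lambda>s. integral {0..s} ((double_integral ^^ m) P))"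
        using Suc.prems
        by (intro continuous_on_subset[OF continuous_on_integral[OF continuous_on_funpow_double_integral[OF P]]]) auto
      fix s assume s: "s \<in> {0..t}"
      have "\<bar>integral {0..s} ((double_integral ^^ m) P)\<bar> \<le> K * T ^ m * s ^ Suc m / fact (Suc m)"
        using s Suc.prems by (intro 1 Suc.IH) auto
      also have "\<dots> \<le> ?L"
        using s Suc.prems K0 by (intro divide_right_mono mult_left_mono power_mono) auto
      finally show "norm (integral {0..s} ((double_integral ^^ m) P)) \<le> ?L" by simp
    qed (use Suc.prems in auto)
    also have "?L * (t - 0) \<le> ?L * T"
      using Suc.prems K0 by (intro mult_left_mono divide_nonneg_nonneg mult_nonneg_nonneg) auto
    finally show ?case by (simp add: double_integral_def[of "(double_integral ^^ m) P"] mult_ac)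
  qed
  show "\<bar>(double_integral ^^ m) P t\<bar> \<le> K * T ^ m * t ^ m / fact m" by (rule 2[OF t])
  show "\<bar>integral {0..t} ((double_integral ^^ m) P)\<bar> \<le> K * T ^ m * t ^ Suc m / fact (Suc m)"
    by (rule 1[OF 2 t])
qed

text \<open>With \<open>J\<close> the double integral, the Neumann series \<open>x = \<Sum>\<^sub>m (J\<^sup>m P) (- B)\<^sup>m c\<close> solves
  \<open>x = c P - J (B x)\<close>, which is the system \<open>x'' + B x = c P''\<close> in integrated form. The function
  \<open>w = x - c P\<close> consists of the terms with \<open>m \<ge> 1\<close>; it is twice differentiable even when \<open>P\<close> is only
  continuous. This separates the regular part of the solution from the rough
  part \<open>c P\<close>, so that one lemma covers both the free motions (\<open>P t = t\<close>, \<open>c\<close> the initial velocity) and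
  the forced solutions (\<open>P'' = f\<close> almost everywhere, \<open>c\<close> the first unit vector).\<close>

lemma linear_second_order_solution:
  fixes P :: "real \<Rightarrow> real" and B :: "nat \<Rightarrow> nat \<Rightarrow> real" and c :: "nat \<Rightarrow> real"
  assumes T: "0 \<le> T" and P: "continuous_on {0..T} P"
  obtains w w' :: "nat \<Rightarrow> real \<Rightarrow> real"
  where "\<And>i t. i < N \<Longrightarrow> t \<in> {0..T} \<Longrightarrow> (w i has_real_derivative w' i t) (at t within {0..T})"
    and "\<And>i t. i < N \<Longrightarrow> t \<in> {0..T} \<Longrightarrow>
          (w' i has_real_derivative - (\<Sum>j<N. B i j * (c j * P t + w j t))) (at t within {0..T})"
    and "\<And>i. i < N \<Longrightarrow> w i 0 = 0" and "\<And>i. i < N \<Longrightarrow> w' i 0 = 0"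
proof -
  define \<alpha> where "\<alpha> = neumann_coeff N B c"
  define R where "R = (\<Sum>i<N. \<Sum>j<N. \<bar>B i j\<bar>)"
  define C where "C = (\<Sum>i<N. \<bar>c i\<bar>)"
  define Q where "Q m = (double_integral ^^ m) P" for m
  define Q' where "Q' m t = integral {0..t} (Q m)" for m t
  have R0: "R \<ge> 0" and C0: "C \<ge> 0" by (auto simp: R_def C_def intro!: sum_nonneg)
  obtain K where K: "\<And>t. t \<in> {0..T} \<Longrightarrow> \<bar>P t\<bar> \<le> K"
    using continuous_on_Icc_bounded[OF P] by blast
  have K0: "K \<ge> 0" using K[of 0] T by auto
  have \<alpha>: "\<bar>\<alpha> m i\<bar> \<le> R ^ m * C" if "i < N" for m i
  proof -
    have "\<bar>\<alpha> m i\<bar> \<le> (\<Sum>i<N. \<bar>\<alpha> m i\<bar>)"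
      using that by (intro member_le_sum) auto
    also have "\<dots> \<le> R ^ m * C" unfolding \<alpha>_def R_def C_def by (rule neumann_coeff_bound)
    finally show ?thesis .
  qed
  have Qc: "continuous_on {0..T} (Q m)" for m
    unfolding Q_def by (rule continuous_on_funpow_double_integral[OF P])
  have DQ': "(Q' m has_real_derivative Q m t) (at t within {0..T})" if "t \<in> {0..T}" for m t
    unfolding Q'_def using integral_has_real_derivative[OF Qc that] .
  have DQ: "(Q (Suc m) has_real_derivative Q' m t) (at t within {0..T})" if "t \<in> {0..T}" for m t
  proof -
    have "Q (Suc m) = (\<lambda>t. integral {0..t} (Q' m))"
      by (simp add: Q_def Q'_def[abs_def] double_integral_def[abs_def])
    then show ?thesis
      unfolding Q'_def using integral_has_real_derivative[OF continuous_on_integral[OF Qc] that] by (simp add: Q'_def[abs_def])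
  qed
  \<comment> \<open>a common majorant of both differentiated series, up to the factor \<open>T\<close>\<close>
  define D where "D m = K * C * R * (R * (T * T)) ^ m / fact m" for m
  have D: "summable D"
  proof -
    have "summable (\<lambda>m. (K * C * R) * (inverse (fact m) * (R * (T * T)) ^ m))"
      by (intro summable_mult summable_exp)
    then show ?thesis by (simp add: D_def[abs_def] field_simps)
  qed
  have DT: "summable (\<lambda>m. D m * T)" using D by (rule summable_mult2)
  have b: "norm (\<alpha> (Suc m) i * Q m t) \<le> D m" "norm (\<alpha> (Suc m) i * Q' m t) \<le> D m * T"
    if "i < N" "t \<in> {0..T}" for i m t
  proof -
    have t: "t ^ k \<le> T ^ k" for k using that by (intro power_mono) auto
    have "\<bar>Q m t\<bar> \<le> K * T ^ m * t ^ m / fact m"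
      unfolding Q_def by (rule funpow_double_integral_bounds(1)[OF P K that(2)])
    also have "\<dots> \<le> K * T ^ m * T ^ m / fact m"
      using t K0 T by (intro divide_right_mono mult_left_mono) auto
    finally have "\<bar>\<alpha> (Suc m) i\<bar> * \<bar>Q m t\<bar> \<le> (R ^ Suc m * C) * (K * T ^ m * T ^ m / fact m)"
      using K0 T R0 C0 by (intro mult_mono \<alpha> that) auto
    also have "\<dots> = D m" by (simp add: D_def power_mult_distrib)
    finally show "norm (\<alpha> (Suc m) i * Q m t) \<le> D m" by (simp add: abs_mult)
    have "\<bar>Q' m t\<bar> \<le> K * T ^ m * t ^ Suc m / fact (Suc m)"
      unfolding Q_def Q'_def by (rule funpow_double_integral_bounds(2)[OF P K that(2)])
    also have "\<dots> \<le> K * T ^ m * T ^ Suc m / fact (Suc m)"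
      by (intro divide_right_mono mult_left_mono t) (use K0 T in auto)
    also have "\<dots> \<le> K * T ^ m * T ^ Suc m / fact m"
      using K0 T by (intro divide_left_mono mult_nonneg_nonneg) (auto intro!: fact_mono)
    finally have "\<bar>\<alpha> (Suc m) i\<bar> * \<bar>Q' m t\<bar> \<le> (R ^ Suc m * C) * (K * T ^ m * T ^ Suc m / fact m)"
      using K0 T R0 C0 by (intro mult_mono \<alpha> that) auto
    also have "\<dots> = D m * T" by (simp add: D_def power_mult_distrib)
    finally show "norm (\<alpha> (Suc m) i * Q' m t) \<le> D m * T" by (simp add: abs_mult)
  qed
  define w where "w i t = (\<Sum>m. \<alpha> (Suc m) i * Q (Suc m) t)" for i t
  define w' where "w' i t = (\<Sum>m. \<alpha> (Suc m) i * Q' m t)" for i t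
  define w'' where "w'' i t = (\<Sum>m. \<alpha> (Suc m) i * Q m t)" for i t
  have Q0: "Q (Suc m) 0 = 0" "Q' m 0 = 0" for m by (simp_all add: Q_def Q'_def double_integral_def)
  have series1: "((\<lambda>m. \<alpha> (Suc m) i * Q (Suc m) t) sums w i t)
      \<and> (w i has_real_derivative w' i t) (at t within {0..T})"
    if i: "i < N" and t: "t \<in> {0..T}" for i t
  proof -
    have "uniform_limit {0..T} (\<lambda>n t. \<Sum>m<n. \<alpha> (Suc m) i * Q' m t) (w' i) sequentially"
      unfolding w'_def by (rule Weierstrass_m_test[OF b(2) DT]) (use i in auto)
    then have "\<exists>g. \<forall>t\<in>{0..T}. (\<lambda>m. \<alpha> (Suc m) i * Q (Suc m) t) sums g t
        \<and> (g has_real_derivative w' i t) (at t within {0..T})"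
      by (intro has_field_derivative_series[of _ _ "\<lambda>m t. \<alpha> (Suc m) i * Q' m t" _ 0]
          DERIV_cmult DQ) (use T Q0 in auto)
    then obtain g where g: "\<And>t. t \<in> {0..T} \<Longrightarrow> (\<lambda>m. \<alpha> (Suc m) i * Q (Suc m) t) sums g t
        \<and> (g has_real_derivative w' i t) (at t within {0..T})"
      by blast
    then have "g t = w i t" if "t \<in> {0..T}" for t
      using that by (auto simp: w_def dest: sums_unique)
    then show ?thesis using g[OF t] t unfolding has_field_derivative_def
      by (auto intro: has_derivative_transform[rotated 2])
  qed
  have series2: "((\<lambda>m. \<alpha> (Suc m) i * Q' m t) sums w' i t)
      \<and> (w' i has_real_derivative w'' i t) (at t within {0..T})"
    if i: "i < N" and t: "t \<in> {0..T}" for i t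
  proof -
    have "uniform_limit {0..T} (\<lambda>n t. \<Sum>m<n. \<alpha> (Suc m) i * Q m t) (w'' i) sequentially"
      unfolding w''_def by (rule Weierstrass_m_test[OF b(1) D]) (use i in auto)
    then have "\<exists>g. \<forall>t\<in>{0..T}. (\<lambda>m. \<alpha> (Suc m) i * Q' m t) sums g t
        \<and> (g has_real_derivative w'' i t) (at t within {0..T})"
      by (intro has_field_derivative_series[of _ _ "\<lambda>m t. \<alpha> (Suc m) i * Q m t" _ 0]
          DERIV_cmult DQ') (use T Q0 in auto)
    then obtain g where g: "\<And>t. t \<in> {0..T} \<Longrightarrow> (\<lambda>m. \<alpha> (Suc m) i * Q' m t) sums g t
        \<and> (g has_real_derivative w'' i t) (at t within {0..T})"
      by blast
    then have "g t = w' i t" if "t \<in> {0..T}" for t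
      using that by (auto simp: w'_def dest: sums_unique)
    then show ?thesis using g[OF t] t unfolding has_field_derivative_def
      by (auto intro: has_derivative_transform[rotated 2])
  qed
  have "w'' i t = - (\<Sum>j<N. B i j * (c j * P t + w j t))" if i: "i < N" and t: "t \<in> {0..T}" for i t
  proof -
    have "(\<lambda>m. \<alpha> m j * Q m t) sums (c j * P t + w j t)" if "j < N" for j
      using sums_Suc[of "\<lambda>m. \<alpha> m j * Q m t"] series1[OF that t]
      by (simp add: \<alpha>_def Q_def add.commute del: neumann_coeff.simps(2) funpow.simps(2))
    then have "(\<lambda>m. - (\<Sum>j<N. B i j * (\<alpha> m j * Q m t))) sums - (\<Sum>j<N. B i j * (c j * P t + w j t))"
      by (intro sums_minus sums_sum sums_mult) auto
    moreover have "- (\<Sum>j<N. B i j * (\<alpha> m j * Q m t)) = \<alpha> (Suc m) i * Q m t" for m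
      by (simp add: \<alpha>_def sum_distrib_right mult.assoc)
    ultimately show ?thesis by (simp add: w''_def sums_iff)
  qed
  then show thesis
    using series1 series2 by (intro that[of w w']) (auto simp: w_def w'_def Q0)
qed

section \<open>Free motions and duality\<close>

text \<open>Unforced motions from the origin with velocity \<open>y\<close>; for a Jacobi matrix these are
  \<open>v(t) = \<Sum>\<^sub>k \<rho>\<^sub>k\<^sup>-\<^sup>1 S\<^sub>k(t) (\<phi>\<^sub>k, y) \<phi>\<^sub>k\<close> in the notation of the eigenvectors
  \<open>\<phi>\<^sub>k\<close>. They are characterized by their equation, which is all that duality needs. The velocity is the
  separate argument \<open>v'\<close> because duality integrates it by parts.\<close>

definition free_motion :: "real \<Rightarrow> real mat \<Rightarrow> real vec \<Rightarrow> (nat \<Rightarrow> real \<Rightarrow> real) \<Rightarrow> (nat \<Rightarrow> real \<Rightarrow> real) \<Rightarrow> bool"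
where
  "free_motion T A y v v' \<longleftrightarrow> (\<forall>i<dim_row A. v i 0 = 0 \<and> v' i 0 = y $ i \<and> (\<forall>t\<in>{0..T}.
     (v i has_real_derivative v' i t) (at t within {0..T}) \<and>
     (v' i has_real_derivative - (\<Sum>j<dim_row A. A $$ (i, j) * v j t)) (at t within {0..T})))"

lemma free_motionD:
  assumes "free_motion T A y v v'" "i < dim_row A"
  shows "v i 0 = 0" "v' i 0 = y $ i"
    and "t \<in> {0..T} \<Longrightarrow> (v i has_real_derivative v' i t) (at t within {0..T})"
    and "t \<in> {0..T} \<Longrightarrow>
      (v' i has_real_derivative - (\<Sum>j<dim_row A. A $$ (i, j) * v j t)) (at t within {0..T})"
  using assms by (auto simp: free_motion_def)

lemma free_motion_exists:
  assumes "0 \<le> T"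
  obtains v v' where "free_motion T A y v v'"
proof -
  obtain w w' where w:
    "\<And>i t. i < dim_row A \<Longrightarrow> t \<in> {0..T} \<Longrightarrow> (w i has_real_derivative w' i t) (at t within {0..T})"
    "\<And>i t. i < dim_row A \<Longrightarrow> t \<in> {0..T} \<Longrightarrow>
       (w' i has_real_derivative - (\<Sum>j<dim_row A. A $$ (i, j) * (y $ j * t + w j t))) (at t within {0..T})"
    "\<And>i. i < dim_row A \<Longrightarrow> w i 0 = 0" "\<And>i. i < dim_row A \<Longrightarrow> w' i 0 = 0"
    using linear_second_order_solution[of T "\<lambda>t. t" "dim_row A" "\<lambda>i j. A $$ (i, j)" "\<lambda>j. y $ j"] assms
      continuous_on_id by blast
  have "free_motion T A y (\<lambda>i t. y $ i * t + w i t) (\<lambda>i t. y $ i + w' i t)"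
    unfolding free_motion_def
    by (auto simp: w(3,4) intro!: derivative_eq_intros w(1,2))
  then show thesis by (rule that)
qed

text \<open>\<open>A\<close> commutes with the flow. Since also \<open>A v = - v''\<close>, this makes the second derivative of a free
  motion a free motion with the initial velocity \<open>- A y\<close>.\<close>

lemma free_motion_mult_mat:
  assumes "free_motion T A y v v'" "A \<in> carrier_mat n n" "y \<in> carrier_vec n"
  shows "free_motion T A (A *\<^sub>v y) (\<lambda>i t. \<Sum>j<n. A $$ (i, j) * v j t) (\<lambda>i t. \<Sum>j<n. A $$ (i, j) * v' j t)"
proof -
  have dim[simp]: "dim_row A = n" "dim_col A = n" using assms(2) by auto
  note v = free_motionD[OF assms(1), unfolded dim]
  show ?thesis
    unfolding free_motion_def
  proof (intro allI impI conjI ballI)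
    fix i t assume i: "i < dim_row A"
    show "(\<Sum>j<n. A $$ (i, j) * v j 0) = 0" by (simp add: v(1))
    show "(\<Sum>j<n. A $$ (i, j) * v' j 0) = (A *\<^sub>v y) $ i"
      using i assms(2,3) by (simp add: v(2) scalar_prod_def lessThan_atLeast0)
    assume t: "t \<in> {0..T}"
    show "((\<lambda>t. \<Sum>j<n. A $$ (i, j) * v j t) has_real_derivative (\<Sum>j<n. A $$ (i, j) * v' j t))
        (at t within {0..T})"
      by (intro DERIV_sum DERIV_cmult v(3) t) auto
    have "((\<lambda>t. \<Sum>j<n. A $$ (i, j) * v' j t) has_real_derivative
        (\<Sum>j<n. A $$ (i, j) * - (\<Sum>k<n. A $$ (j, k) * v k t))) (at t within {0..T})"
      by (intro DERIV_sum DERIV_cmult v(4) t) auto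
    then show "((\<lambda>t. \<Sum>j<n. A $$ (i, j) * v' j t) has_real_derivative
        - (\<Sum>j<dim_row A. A $$ (i, j) * (\<Sum>k<n. A $$ (j, k) * v k t))) (at t within {0..T})"
      by (simp add: sum_negf)
  qed
qed

lemma has_derivative_reflect:
  fixes h :: "real \<Rightarrow> real"
  assumes "\<And>t. t \<in> {0..T} \<Longrightarrow> (h has_real_derivative h' t) (at t within {0..T})" and "t \<in> {0..T}"
  shows "((\<lambda>s. h (T - s)) has_real_derivative - h' (T - t)) (at t within {0..T})"
proof -
  have img: "(\<lambda>s. T - s) ` {0..T} = {0..T}"
    using image_diff_atLeastAtMost[of T 0 T] by simp
  have "(h has_real_derivative h' (T - t)) (at (T - t) within (\<lambda>s. T - s) ` {0..T})"
    unfolding img using assms by simp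
  moreover have "((\<lambda>s. T - s) has_real_derivative - 1) (at t within {0..T})"
    by (auto intro!: derivative_eq_intros)
  ultimately show ?thesis
    using DERIV_image_chain[of h "h' (T - t)" "\<lambda>s. T - s" t "{0..T}" "-1"] by (simp add: o_def)
qed

lemma continuous_on_reflect:
  fixes h :: "real \<Rightarrow> real"
  assumes "continuous_on {0..T} h"
  shows "continuous_on {0..T} (\<lambda>s. h (T - s))"
  by (rule continuous_on_compose2[OF assms]) (auto intro!: continuous_intros)

text \<open>Reversing time in \<open>v\<close> exchanges the vanishing initial data of \<open>u\<close> with vanishing final data. Two
  integrations by parts move the time derivatives from \<open>u\<close> to \<open>v\<close>; the only boundary term that
  survives is \<open>u(T) \<bullet> y\<close>, and by symmetry of \<open>A\<close> only the force remains under the integral. The first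
  integration by parts concerns the absolutely continuous \<open>u'\<close>, the second one is classical.\<close>

lemma solution_dual_free_motion:
  assumes A: "A \<in> carrier_mat n n" and sym: "\<And>i j. i < n \<Longrightarrow> j < n \<Longrightarrow> A $$ (i, j) = A $$ (j, i)"
    and n: "0 < n" and T: "0 < T"
    and f: "f \<in> L2 T" and u: "solves_system T A f u" and v: "free_motion T A y v v'" and y: "y \<in> carrier_vec n"
  shows "u T \<bullet> y = L2_inner T f (\<lambda>t. v 0 (T - t))"
proof -
  let ?M = "lebesgue_on {0<..<T}"
  have dim[simp]: "dim_row A = n" "dim_col A = n" using A by auto
  obtain u1 u2 where u0: "\<And>t. t \<in> {0..T} \<Longrightarrow> u t \<in> carrier_vec n" "u 0 = 0\<^sub>v n"
    and u1: "\<And>i t. i < n \<Longrightarrow> t \<in> {0..T} \<Longrightarrow>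
      ((\<lambda>s. u s $ i) has_real_derivative u1 t $ i) (at t within {0..T})"
    and u2: "\<And>i. i < n \<Longrightarrow> integrable ?M (\<lambda>s. u2 s $ i)"
    and u12: "\<And>i t. i < n \<Longrightarrow> t \<in> {0..T} \<Longrightarrow> u1 t $ i = (LINT s|lebesgue_on {0<..<t}. u2 s $ i)"
    and eq: "AE t in ?M. u2 t \<in> carrier_vec n \<and> u2 t + A *\<^sub>v u t = f t \<cdot>\<^sub>v unit_vec n 0"
    using u unfolding solves_system_def dim by blast
  note vD = free_motionD[OF v, unfolded dim]
  define z where "z i t = (\<Sum>j<n. A $$ (i, j) * v j t)" for i t
  have vc: "continuous_on {0..T} (v i)" and v'c: "continuous_on {0..T} (v' i)" if "i < n" for i
    using DERIV_continuous_on[OF vD(3)[OF that]] DERIV_continuous_on[OF vD(4)[OF that]] by auto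
  have uc: "continuous_on {0..T} (\<lambda>s. u s $ i)" if "i < n" for i
    using u1[OF that] by (rule DERIV_continuous_on)
  have zc: "continuous_on {0..T} (z i)" if "i < n" for i
    unfolding z_def by (intro continuous_intros vc) auto
  have cont_u1: "continuous_on {0..T} (\<lambda>t. u1 t $ i)" if "i < n" for i
    by (rule continuous_on_eq[OF continuous_on_indefinite_LINT[OF u2[OF that]]]) (simp add: u12[OF that])
  have parts: "(LINT t|?M. u2 t $ i * v i (T - t)) =
      u T $ i * y $ i - (LINT t|?M. u t $ i * z i (T - t))" if i: "i < n" for i
  proof -
    have "(LINT t|?M. u2 t $ i * v i (T - t)) =
        - (LINT t|?M. (LINT s|lebesgue_on {0<..<t}. u2 s $ i) * - v' i (T - t))"
      using i by (intro LINT_by_parts_indefinite u2 has_derivative_reflect)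
        (auto intro!: continuous_intros continuous_on_reflect v'c simp: vD)
    also have "\<dots> = (LINT t|?M. (LINT s|lebesgue_on {0<..<t}. u2 s $ i) * v' i (T - t))"
      by simp
    also have "\<dots> = (LINT t|?M. u1 t $ i * v' i (T - t))"
      by (rule Bochner_Integration.integral_cong) (simp_all add: u12[OF i])
    also have "\<dots> = (LINT t|?M. (u1 t $ i * v' i (T - t) + u t $ i * z i (T - t)) - u t $ i * z i (T - t))"
      by simp
    also have "\<dots> = (LINT t|?M. u1 t $ i * v' i (T - t) + u t $ i * z i (T - t))
        - (LINT t|?M. u t $ i * z i (T - t))"
      by (intro Bochner_Integration.integral_diff integrable_lebesgue_on_Ioo_continuous continuous_intros
          continuous_on_reflect cont_u1 v'c uc zc i)
    also have "(LINT t|?M. u1 t $ i * v' i (T - t) + u t $ i * z i (T - t)) =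
        u T $ i * v' i (T - T) - u 0 $ i * v' i (T - 0)"
    proof (rule LINT_Ioo_FTC)
      fix t assume t: "t \<in> {0..T}"
      have "((\<lambda>t. v' i (T - t)) has_real_derivative - (- z i (T - t))) (at t within {0..T})"
        using t vD(4)[OF i] unfolding z_def by (intro has_derivative_reflect) auto
      from DERIV_mult[OF u1[OF i t] this]
      show "((\<lambda>t. u t $ i * v' i (T - t)) has_real_derivative
          u1 t $ i * v' i (T - t) + u t $ i * z i (T - t)) (at t within {0..T})"
        by (simp add: algebra_simps)
    qed (use T in \<open>auto intro!: continuous_intros continuous_on_reflect cont_u1 v'c uc zc i\<close>)
    also have "\<dots> = u T $ i * y $ i" using i by (simp add: u0(2) vD(2))
    finally show ?thesis .
  qed
  have int1: "integrable ?M (\<lambda>t. u2 t $ i * v i (T - t))" if "i < n" for i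
    using that by (intro integrable_mult_continuous u2 continuous_on_reflect vc)
  have int2: "integrable ?M (\<lambda>t. u t $ i * z i (T - t))" if "i < n" for i
    using that by (intro integrable_lebesgue_on_Ioo_continuous continuous_intros continuous_on_reflect uc zc)
  have "u T \<bullet> y = (\<Sum>i<n. u T $ i * y $ i)"
    using y by (simp add: scalar_prod_def lessThan_atLeast0)
  also have "\<dots> = (\<Sum>i<n. (LINT t|?M. u2 t $ i * v i (T - t)) + (LINT t|?M. u t $ i * z i (T - t)))"
    by (intro sum.cong) (simp_all add: parts)
  also have "\<dots> = (LINT t|?M. (\<Sum>i<n. u2 t $ i * v i (T - t) + u t $ i * z i (T - t)))"
  proof -
    have "(LINT t|?M. (\<Sum>i<n. u2 t $ i * v i (T - t) + u t $ i * z i (T - t))) =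
        (\<Sum>i<n. LINT t|?M. u2 t $ i * v i (T - t) + u t $ i * z i (T - t))"
      by (rule Bochner_Integration.integral_sum) (auto intro!: int1 int2)
    also have "\<dots> = (\<Sum>i<n. (LINT t|?M. u2 t $ i * v i (T - t)) + (LINT t|?M. u t $ i * z i (T - t)))"
      by (intro sum.cong refl Bochner_Integration.integral_add int1 int2) auto
    finally show ?thesis by simp
  qed
  also have "\<dots> = (LINT t|?M. f t * v 0 (T - t))"
  proof (rule integral_cong_AE)
    show "(\<lambda>t. \<Sum>i<n. u2 t $ i * v i (T - t) + u t $ i * z i (T - t)) \<in> borel_measurable ?M"
      using int1 int2 by (intro borel_measurable_sum borel_measurable_add borel_measurable_integrable) auto
    have "AE t in ?M. (\<Sum>i<n. u2 t $ i * v i (T - t) + u t $ i * z i (T - t)) = f t * v 0 (T - t)"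
      using eq AE_space
    proof eventually_elim
      case (elim t)
      then have t: "t \<in> {0..T}" and c: "u2 t \<in> carrier_vec n" "u t \<in> carrier_vec n" using u0(1)[of t] by auto
      have e: "u2 t $ i = (if i = 0 then f t else 0) - (\<Sum>j<n. A $$ (i, j) * u t $ j)" if "i < n" for i
      proof -
        have "(u2 t + A *\<^sub>v u t) $ i = (f t \<cdot>\<^sub>v unit_vec n 0) $ i" using elim by simp
        then show ?thesis using that c n A
          by (auto simp: scalar_prod_def lessThan_atLeast0 split: if_splits)
      qed
      have sym': "(\<Sum>i<n. u t $ i * z i (T - t)) = (\<Sum>i<n. (\<Sum>j<n. A $$ (i, j) * u t $ j) * v i (T - t))"
      proof -
        have "(\<Sum>i<n. u t $ i * z i (T - t)) = (\<Sum>i<n. \<Sum>j<n. u t $ i * (A $$ (i, j) * v j (T - t)))"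
          by (simp add: z_def sum_distrib_left)
        also have "\<dots> = (\<Sum>j<n. \<Sum>i<n. u t $ i * (A $$ (i, j) * v j (T - t)))" by (rule sum.swap)
        also have "\<dots> = (\<Sum>i<n. (\<Sum>j<n. A $$ (i, j) * u t $ j) * v i (T - t))"
          unfolding sum_distrib_right by (intro sum.cong) (auto simp: sym)
        finally show ?thesis .
      qed
      have "(\<Sum>i<n. u2 t $ i * v i (T - t)) =
          (\<Sum>i<n. (if i = 0 then f t * v i (T - t) else 0) - (\<Sum>j<n. A $$ (i, j) * u t $ j) * v i (T - t))"
        by (intro sum.cong) (auto simp: e left_diff_distrib)
      also have "\<dots> = f t * v 0 (T - t) - (\<Sum>i<n. (\<Sum>j<n. A $$ (i, j) * u t $ j) * v i (T - t))"
        using n by (simp add: sum_subtractf)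
      finally show ?case by (simp add: sum.distrib sym')
    qed
    then show "AE t in ?M. (\<Sum>i<n. u2 t $ i * v i (T - t) + u t $ i * z i (T - t)) = f t * v 0 (T - t)" .
    show "(\<lambda>t. f t * v 0 (T - t)) \<in> borel_measurable ?M"
      using integrable_mult_continuous[OF L2_imp_integrable[OF f] continuous_on_reflect[OF vc[OF n]]] by auto
  qed
  finally show ?thesis by (simp add: L2_inner_def)
qed

section \<open>The control operator and the connecting operator\<close>

text \<open>Splitting off \<open>P\<close> with \<open>P'' = f\<close> in the first component leaves a classical system for \<open>w\<close>.\<close>

lemma solves_system_exists:
  assumes A: "A \<in> carrier_mat n n" and T: "0 < T" and f: "f \<in> L2 T"
  obtains u where "solves_system T A f u"
proof -
  have [simp]: "dim_row A = n" "dim_col A = n" using A by auto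
  define q where "q t = (LINT s|lebesgue_on {0<..<t}. f s)" for t
  define P where "P t = integral {0..t} q" for t
  define e where "e i = (if i = 0 then 1 else 0 :: real)" for i :: nat
  note fi = L2_imp_integrable[OF f]
  have q: "continuous_on {0..T} q"
    unfolding q_def by (rule continuous_on_indefinite_LINT[OF fi])
  have DP: "(P has_real_derivative q t) (at t within {0..T})" if "t \<in> {0..T}" for t
    unfolding P_def by (rule integral_has_real_derivative[OF q that])
  then have P: "continuous_on {0..T} P" by (rule DERIV_continuous_on)
  obtain w w' where w:
    "\<And>i t. i < n \<Longrightarrow> t \<in> {0..T} \<Longrightarrow> (w i has_real_derivative w' i t) (at t within {0..T})"
    "\<And>i t. i < n \<Longrightarrow> t \<in> {0..T} \<Longrightarrow>
       (w' i has_real_derivative - (\<Sum>j<n. A $$ (i, j) * (e j * P t + w j t))) (at t within {0..T})"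
    "\<And>i. i < n \<Longrightarrow> w i 0 = 0" "\<And>i. i < n \<Longrightarrow> w' i 0 = 0"
    using linear_second_order_solution[OF less_imp_le[OF T] P, of n "\<lambda>i j. A $$ (i, j)" e] by blast
  define w'' where "w'' i t = - (\<Sum>j<n. A $$ (i, j) * (e j * P t + w j t))" for i t
  have w''c: "continuous_on {0..T} (w'' i)" for i
    unfolding w''_def using DERIV_continuous_on[OF w(1)]
    by (auto intro!: continuous_intros P)
  have "solves_system T A f (\<lambda>t. vec n (\<lambda>i. e i * P t + w i t))"
    unfolding solves_system_def \<open>dim_row A = n\<close>
  proof (intro conjI; (rule exI[of _ "\<lambda>t. vec n (\<lambda>i. e i * q t + w' i t)"],
      rule exI[of _ "\<lambda>t. vec n (\<lambda>i. e i * f t + w'' i t)"], intro conjI allI impI ballI AE_I2)?)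
    show "vec n (\<lambda>i. e i * P 0 + w i 0) = 0\<^sub>v n"
      by (auto simp: P_def w(3))
    fix i assume i: "i < n"
    show "integrable (lebesgue_on {0<..<T}) (\<lambda>s. vec n (\<lambda>i. e i * f s + w'' i s) $ i)"
      using i fi integrable_lebesgue_on_Ioo_continuous[OF w''c] by simp
    fix t assume t: "t \<in> {0..T}"
    show "((\<lambda>s. vec n (\<lambda>i. e i * P s + w i s) $ i) has_real_derivative
        vec n (\<lambda>i. e i * q t + w' i t) $ i) (at t within {0..T})"
      using i by (simp add: DERIV_add DERIV_cmult DP[OF t] w(1)[OF i t])
    have "(LINT s|lebesgue_on {0<..<t}. e i * f s + w'' i s) =
        e i * q t + (LINT s|lebesgue_on {0<..<t}. w'' i s)"
      using t integrable_lebesgue_on_Ioo_subset[OF fi, of t]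
        integrable_lebesgue_on_Ioo_subset[OF integrable_lebesgue_on_Ioo_continuous[OF w''c], of t]
      by (simp add: q_def)
    also have "(LINT s|lebesgue_on {0<..<t}. w'' i s) = w' i t - w' i 0"
    proof (rule LINT_Ioo_FTC)
      show "continuous_on {0..t} (w'' i)" using t by (intro continuous_on_subset[OF w''c]) auto
      show "(w' i has_real_derivative w'' i s) (at s within {0..t})" if "s \<in> {0..t}" for s
        using that t unfolding w''_def by (intro DERIV_subset[OF w(2)[OF i]]) auto
    qed (use t in auto)
    finally show "vec n (\<lambda>i. e i * q t + w' i t) $ i =
        (LINT s|lebesgue_on {0<..<t}. vec n (\<lambda>i. e i * f s + w'' i s) $ i)"
      using i by (simp add: w(4))
  next
    fix t
    show "vec n (\<lambda>i. e i * f t + w'' i t) + A *\<^sub>v vec n (\<lambda>i. e i * P t + w i t) =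
        f t \<cdot>\<^sub>v unit_vec n 0"
      using A by (intro eq_vecI) (auto simp: w''_def e_def scalar_prod_def lessThan_atLeast0)
  qed auto
  then show thesis by (rule that)
qed

context
  fixes n :: nat and T :: real and A :: "real mat"
  assumes A: "A \<in> carrier_mat n n" and n: "0 < n" and T: "0 < T"
    and sym: "\<And>i j. i < n \<Longrightarrow> j < n \<Longrightarrow> A $$ (i, j) = A $$ (j, i)"
begin

text \<open>Uniqueness of the final state is another use of duality: its inner products with all unit
  vectors are determined by \<open>f\<close> alone.\<close>

lemma control_op_solution:
  assumes f: "f \<in> L2 T"
  obtains u where "solves_system T A f u" "control_op T A f = u T"
proof -
  obtain u where u: "solves_system T A f u"
    using solves_system_exists[OF A T f] .
  have uT: "u T \<in> carrier_vec n" if "solves_system T A f u" for u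
    using that T A unfolding solves_system_def by auto
  \<comment> \<open>duality gives the \<open>i\<close>-th component when the free motion has velocity \<open>unit_vec n i\<close>\<close>
  have uniq: "u' T = u T" if u': "solves_system T A f u'" for u'
  proof (rule eq_vecI)
    fix i assume "i < dim_vec (u T)"
    then have i: "i < n" using uT[OF u] by auto
    obtain v v' where v: "free_motion T A (unit_vec n i) v v'"
      using free_motion_exists[of T A "unit_vec n i"] T by auto
    have "u' T \<bullet> unit_vec n i = u T \<bullet> unit_vec n i"
      using solution_dual_free_motion[OF A sym n T f u' v] solution_dual_free_motion[OF A sym n T f u v] by simp
    then show "u' T $ i = u T $ i"
      using i uT[OF u] uT[OF u'] by simp
  qed (use uT[OF u] uT[OF u'] in auto)
  have "control_op T A f = u T"
    unfolding control_op_def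
  proof (rule the_equality)
    show "\<exists>u'. solves_system T A f u' \<and> u T = u' T" using u by blast
    show "x = u T" if "\<exists>u'. solves_system T A f u' \<and> x = u' T" for x using that uniq by blast
  qed
  then show thesis using u that by blast
qed

lemma control_op_carrier:
  assumes "f \<in> L2 T"
  shows "control_op T A f \<in> carrier_vec n"
  using control_op_solution[OF assms] T A unfolding solves_system_def by (metis atLeastAtMost_iff carrier_matD(1) less_imp_le order_refl)

lemma control_op_dual:
  assumes f: "f \<in> L2 T" and y: "y \<in> carrier_vec n" and v: "free_motion T A y v v'"
  shows "control_op T A f \<bullet> y = L2_inner T f (\<lambda>t. v 0 (T - t))"
  using control_op_solution[OF f] solution_dual_free_motion[OF A sym n T f _ v y] by metis

text \<open>Duality exhibits a representative of the adjoint. Any other element \<open>g\<close> with the same inner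
  products agrees with it almost everywhere, as testing with the difference \<open>h - g\<close> shows.\<close>

lemma L2_adjoint_control_op:
  assumes y: "y \<in> carrier_vec n" and v: "free_motion T A y v v'"
  shows "L2_eq T (\<lambda>t. v 0 (T - t)) (L2_adjoint T (control_op T A) y)"
proof -
  define h where "h t = v 0 (T - t)" for t
  define g where "g = L2_adjoint T (control_op T A) y"
  have "continuous_on {0..T} (v 0)"
    using free_motionD(3)[OF v, of 0] A n by (intro DERIV_continuous_on) auto
  then have h: "h \<in> L2 T"
    unfolding h_def by (intro L2_continuous continuous_on_reflect)
  have hf: "control_op T A f \<bullet> y = L2_inner T f h" if "f \<in> L2 T" for f
    unfolding h_def by (rule control_op_dual[OF that y v])
  have "\<exists>g. g \<in> L2 T \<and> (\<forall>f\<in>L2 T. control_op T A f \<bullet> y = L2_inner T f g)"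
    using h hf by blast
  from someI_ex[OF this]
  have g: "g \<in> L2 T" and gf: "\<And>f. f \<in> L2 T \<Longrightarrow> control_op T A f \<bullet> y = L2_inner T f g"
    unfolding g_def L2_adjoint_def by blast+
  note int = L2_imp_integrable_mult[OF h h] L2_imp_integrable_mult[OF h g]
    L2_imp_integrable_mult[OF g h] L2_imp_integrable_mult[OF g g]
  have sq: "(h t - g t)\<^sup>2 = h t * h t - h t * g t - (g t * h t - g t * g t)" for t
    by (simp add: power2_eq_square algebra_simps)
  have "(LINT t|lebesgue_on {0<..<T}. (h t - g t)\<^sup>2) =
      L2_inner T h h - L2_inner T h g - (L2_inner T g h - L2_inner T g g)"
    unfolding sq L2_inner_def
    using int by (simp add: Bochner_Integration.integral_diff) (simp add: mult.commute)
  also have "\<dots> = 0" using hf[OF h] gf[OF h] hf[OF g] gf[OF g] by simp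
  finally have "(LINT t|lebesgue_on {0<..<T}. (h t - g t)\<^sup>2) = 0" .
  moreover have "integrable (lebesgue_on {0<..<T}) (\<lambda>t. (h t - g t)\<^sup>2)"
    unfolding sq using int by simp
  ultimately have "AE t in lebesgue_on {0<..<T}. (h t - g t)\<^sup>2 = 0"
    by (subst integral_nonneg_eq_0_iff_AE[symmetric]) auto
  then show ?thesis by (simp add: L2_eq_def g_def h_def)
qed

end

text \<open>The intertwining relation \<open>(W\<^sup>* y)'' = - W\<^sup>* A y\<close>, tested against \<open>h\<close>, with \<open>y = W f\<close>: the function
  \<open>W\<^sup>* y\<close> is the first component of the reversed free motion with velocity \<open>y\<close>, and its second derivative
  is, up to sign, that of the free motion with velocity \<open>A y\<close>.\<close>

lemma L2_second_deriv_connecting_op: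
  assumes A: "A \<in> carrier_mat n n" and n: "0 < n" and T: "0 < T"
    and sym: "\<And>i j. i < n \<Longrightarrow> j < n \<Longrightarrow> A $$ (i, j) = A $$ (j, i)"
    and f: "f \<in> L2 T" and h: "h \<in> L2 T"
  shows "L2_inner T (L2_second_deriv T (connecting_op T A f)) h =
         - (control_op T A h \<bullet> (A *\<^sub>v control_op T A f))"
proof -
  define y where "y = control_op T A f"
  have y: "y \<in> carrier_vec n" unfolding y_def by (rule control_op_carrier[OF A n T sym f])
  have dim: "dim_row A = n" using A by simp
  obtain v v' where v: "free_motion T A y v v'"
    using free_motion_exists[of T A y] T by auto
  define z where "z = (\<lambda>i t. \<Sum>j<n. A $$ (i, j) * v j t)"
  have z: "free_motion T A (A *\<^sub>v y) z (\<lambda>i t. \<Sum>j<n. A $$ (i, j) * v' j t)"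
    unfolding z_def by (rule free_motion_mult_mat[OF v A y])
  note vD = free_motionD(3,4)[OF v, unfolded dim, OF n]
  have at: "at t within {0..T} = at t" if "t \<in> {0<..<T}" for t
    using that by (intro at_within_interior) (simp add: interior_atLeastAtMost_real)
  have second: "L2_second_deriv T (connecting_op T A f) t = - z 0 (T - t)" if t: "t \<in> {0<..<T}" for t
  proof (rule L2_second_deriv_eq[OF _ _ _ t])
    show "L2_eq T (\<lambda>t. v 0 (T - t)) (connecting_op T A f)"
      unfolding connecting_op_def y_def[symmetric]
      by (rule L2_adjoint_control_op[OF A n T sym y v])
    fix s assume s: "s \<in> {0<..<T}"
    then have s': "s \<in> {0..T}" by simp
    show "((\<lambda>t. v 0 (T - t)) has_real_derivative - v' 0 (T - s)) (at s)"
      using has_derivative_reflect[OF vD(1) s'] at[OF s] by simp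
    show "((\<lambda>t. - v' 0 (T - t)) has_real_derivative - z 0 (T - s)) (at s)"
      using DERIV_minus[OF has_derivative_reflect[OF vD(2) s']] at[OF s] by (simp add: z_def)
  qed
  have "L2_inner T (L2_second_deriv T (connecting_op T A f)) h =
      (LINT t|lebesgue_on {0<..<T}. - (h t * z 0 (T - t)))"
    unfolding L2_inner_def by (rule Bochner_Integration.integral_cong) (simp_all add: second)
  also have "\<dots> = - L2_inner T h (\<lambda>t. z 0 (T - t))"
    by (simp add: L2_inner_def)
  also have "L2_inner T h (\<lambda>t. z 0 (T - t)) = control_op T A h \<bullet> (A *\<^sub>v y)"
    using A y by (intro control_op_dual[OF A n T sym h _ z, symmetric]) auto
  finally show ?thesis by (simp add: y_def)
qed

section \<open>Recovery of the matrix entries\<close>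

lemma jacobi_mat_index:
  "i < N \<Longrightarrow> jacobi_mat N a b $$ (i, i) = b (i + 1)"
  "Suc i < N \<Longrightarrow> jacobi_mat N a b $$ (i, Suc i) = a (i + 1)"
  "Suc i < N \<Longrightarrow> jacobi_mat N a b $$ (Suc i, i) = a (i + 1)"
  by (simp_all add: jacobi_mat_def)

theorem mainTheorem3:
  fixes N :: nat and T :: real and a b :: "nat \<Rightarrow> real" and A :: "real mat"
    and f :: "nat \<Rightarrow> real \<Rightarrow> real"
  assumes "N \<ge> 2" and "T > 0"
    and "\<And>i. i \<in> {1..N - 1} \<Longrightarrow> a i > 0"
    and "A = jacobi_mat N a b"
    and "\<And>k. k \<in> {1..N} \<Longrightarrow> f k \<in> control_subspace T A"
    and "\<And>k. k \<in> {1..N} \<Longrightarrow> control_op T A (f k) = unit_vec N (k - 1)"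
  shows "(\<forall>n\<in>{1..N}.
            b n = - L2_inner T (L2_second_deriv T (connecting_op T A (f n))) (f n)) \<and>
         (\<forall>n\<in>{1..N - 1}.
            a n = - L2_inner T (L2_second_deriv T (connecting_op T A (f n))) (f (n + 1)) \<and>
            a n = - L2_inner T (L2_second_deriv T (connecting_op T A (f (n + 1)))) (f n))"
proof -
  have A: "A \<in> carrier_mat N N"
    by (simp add: assms(4) jacobi_mat_def)
  have sym: "A $$ (i, j) = A $$ (j, i)" if "i < N" "j < N" for i j
    using that by (auto simp: assms(4) jacobi_mat_def)
  have entry: "- L2_inner T (L2_second_deriv T (connecting_op T A (f n))) (f m) = A $$ (m - 1, n - 1)"
    if "n \<in> {1..N}" "m \<in> {1..N}" for n m
  proof -
    have "m - 1 < N" "n - 1 < N" using that by auto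
    have f: "f n \<in> L2 T" "f m \<in> L2 T"
      using assms(5) that by (auto simp: control_subspace_def)
    have "- L2_inner T (L2_second_deriv T (connecting_op T A (f n))) (f m) =
        unit_vec N (m - 1) \<bullet> (A *\<^sub>v unit_vec N (n - 1))"
      using L2_second_deriv_connecting_op[OF A _ assms(2) sym f] assms(1,6) that by simp
    also have "\<dots> = A $$ (m - 1, n - 1)"
      proof -
      have "unit_vec N (m - 1) \<bullet> (A *\<^sub>v unit_vec N (n - 1)) = (A *\<^sub>v unit_vec N (n - 1)) $ (m - 1)"
        by (rule scalar_prod_left_unit) (use A that in auto)
      also have "\<dots> = A $$ (m - 1, n - 1)"
        using A \<open>m - 1 < N\<close> \<open>n - 1 < N\<close> by simp
      finally show ?thesis .
    qed
    finally show ?thesis .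
  qed
  show ?thesis
  proof (intro conjI ballI)
    show "b n = - L2_inner T (L2_second_deriv T (connecting_op T A (f n))) (f n)"
      if "n \<in> {1..N}" for n
    proof -
      have "n - 1 < N" "Suc (n - 1) = n" using that by auto
      then show ?thesis
        unfolding entry[OF that that] using jacobi_mat_index(1)[OF \<open>n - 1 < N\<close>] by (simp add: assms(4))
    qed
    fix n assume n: "n \<in> {1..N - 1}"
    then have k: "n \<in> {1..N}" "n + 1 \<in> {1..N}" "Suc (n - 1) = n" "Suc (n - 1) < N" by auto
    show "a n = - L2_inner T (L2_second_deriv T (connecting_op T A (f n))) (f (n + 1))"
      unfolding entry[OF k(1,2)] using jacobi_mat_index(3)[OF k(4)] k(3) by (simp add: assms(4))
    show "a n = - L2_inner T (L2_second_deriv T (connecting_op T A (f (n + 1)))) (f n)"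
      unfolding entry[OF k(2,1)] using jacobi_mat_index(2)[OF k(4)] k(3) by (simp add: assms(4))
  qed
qed

end
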